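(* Let $V=\mathbb{C}(z)$ or $V=\mathbb{C}((z))$, and let $\rho\in\mathcal{S}$ be the representation associated to a triple $(h(z),b(z),c)$. If $\mathcal{U}(\mathfrak{sl}(2))$ is the universal enveloping algebra of $\mathfrak{sl}(2)$ and $\mathcal{C}$ is the Casimir operator, then $\rho$ induces an injection $$\mathcal{U}(\mathfrak{sl}(2))/\langle\mathcal{C}-(2c+1)^2\rangle\hookrightarrow\mathrm{Diff}(\mathbb{C}((z))).$$
   Context: $\mathfrak{sl}(2)$ is the complex Lie algebra with basis $L_{-1},L_0,L_1$ and $[L_i,L_j]=(i-j)L_{i+j}$. $\mathrm{Diff}(V)$ is the algebra of differential operators on $V$: finite sums $\sum_{j=0}^k\xi_j\partial^j$ with $\xi_j\in V$, $\partial=\frac{\partial}{\partial z}$, a Lie algebra under commutator; order $k$ if $\xi_k\ne0$. $\mathrm{Diff}(\mathbb{C}(z))\subset\mathrm{Diff}(\mathbb{C}((z)))$ via $\mathbb{C}(z)\subset\mathbb{C}((z))$. $\mathcal{C}=4\left((L_0-\frac12)^2-L_{-1}L_1\right)\in\mathcal{U}(\mathfrak{sl}(2))$ and $\langle\cdot\rangle$ denotes the two-sided ideal generated. $\mathcal{S}$ is the set of Lie algebra homomorphisms $\rho:\mathfrak{sl}(2)\to\mathrm{Diff}(V)$ with $\rho(L_0)$ of order $1$. It is the disjoint union of $\mathcal{S}_i=\{\rho\in\mathcal{S}:\mathrm{ord}(\rho(L_{-1}))=i\}$, $i=0,1,2$, and each $\rho$ is associated to a unique triple $(h,b,c)$,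 $h,b\in V$, $h'\neq0$, with $c\in\mathbb{C}_{\mathrm{sl}}$ if $\rho\in\mathcal{S}_0\cup\mathcal{S}_2$ and $c\in\mathbb{C}$ if $\rho\in\mathcal{S}_1$, via: - $\mathcal{S}_0$: $\rho(L_{-1})=h^{-1}$, $\rho(L_0)=-\frac{h}{h'}\partial+b$, $\rho(L_1)=h(\rho(L_0)^2-\rho(L_0)-c(c+1))$; - $\mathcal{S}_1$: $\rho(L_i)=-\frac{h^{i+1}}{h'}\partial+(b+ic)h^i$, $i=-1,0,1$; - $\mathcal{S}_2$: $\rho(L_{-1})=h^{-1}(\rho(L_0)^2+\rho(L_0)-c(c+1))$, $\rho(L_0)=-\frac{h}{h'}\partial+b$, $\rho(L_1)=h$. Here $\mathbb{C}_{\mathrm{sl}}:=\{\mu\in\mathbb{C}:\mathrm{Re}(\mu)=-\frac12,\ \mathrm{Im}(\mu)\ge0\}\sqcup\{\mu\in\mathbb{C}:\mathrm{Re}(\mu)>-\frac12\}$. *)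

theory Defs
  imports
    "HOL-Computational_Algebra.Computational_Algebra"
    "HOL-Library.Product_Plus"
    "HOL-Library.Poly_Mapping"
    "HOL-Algebra.Algebraic_Closure_Type"
begin

section \<open>The Lie algebra sl(2)\<close>

text \<open>A triple \<open>(x, y, z)\<close> stands for \<open>x L\<^sub>-\<^sub>1 + y L\<^sub>0 + z L\<^sub>1\<close>.\<close>

type_synonym sl2 = "complex \<times> complex \<times> complex"

definition sl2_L :: "int \<Rightarrow> sl2" where
  "sl2_L i = (of_bool (i = -1), of_bool (i = 0), of_bool (i = 1))"

fun sl2_scale :: "complex \<Rightarrow> sl2 \<Rightarrow> sl2" where
  "sl2_scale a (x, y, z) = (a * x, a * y, a * z)"

fun sl2_bracket :: "sl2 \<Rightarrow> sl2 \<Rightarrow> sl2" where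
  "sl2_bracket (x, y, z) (x', y', z') = (y * x' - x * y', 2 * (z * x' - x * z'), z * y' - y * z')"

lemma sl2_bracket_L:
  "i \<in> {-1, 0, 1} \<Longrightarrow> j \<in> {-1, 0, 1} \<Longrightarrow>
    sl2_bracket (sl2_L i) (sl2_L j) = sl2_scale (of_int (i - j)) (sl2_L (i + j))"
  by (auto simp: sl2_L_def)

lemma sl2_basis:
  "(x, y, z) = sl2_scale x (sl2_L (-1)) + sl2_scale y (sl2_L 0) + sl2_scale z (sl2_L 1)"
  by (simp add: sl2_L_def)

lemma sl2_bracket_bilinear:
  "sl2_bracket (x + x') y = sl2_bracket x y + sl2_bracket x' y"
  "sl2_bracket x (y + y') = sl2_bracket x y + sl2_bracket x y'"
  "sl2_bracket (sl2_scale a x) y = sl2_scale a (sl2_bracket x y)"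
  "sl2_bracket x (sl2_scale a y) = sl2_scale a (sl2_bracket x y)"
  by (cases x; cases x'; cases y; cases y'; simp add: algebra_simps)+

lemma sl2_bracket_self: "sl2_bracket x x = 0"
  by (cases x) (simp add: zero_prod_def)

lemma sl2_jacobi:
  "sl2_bracket x (sl2_bracket y z) + sl2_bracket y (sl2_bracket z x)
    + sl2_bracket z (sl2_bracket x y) = 0"
  by (cases x; cases y; cases z) (simp add: zero_prod_def algebra_simps)


section \<open>The universal enveloping algebra\<close>

datatype 'g fmonoid = Word "'g list"

instantiation fmonoid :: (type) monoid_add
begin

definition zero_fmonoid :: "'a fmonoid" where
  "0 = Word []"

fun plus_fmonoid :: "'a fmonoid \<Rightarrow> 'a fmonoid \<Rightarrow> 'a fmonoid" where
  "Word u + Word v = Word (u @ v)"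

instance
proof
  fix a b c :: "'a fmonoid"
  show "a + b + c = a + (b + c)"
    by (cases a; cases b; cases c) simp
  show "0 + a = a" "a + 0 = a"
    by (cases a; simp add: zero_fmonoid_def)+
qed

end

text \<open>The free unital associative complex algebra on the set underlying \<open>'g\<close>: the monoid
  algebra of the free monoid, with the convolution product of \<^theory>\<open>HOL-Library.Poly_Mapping\<close>.\<close>

type_synonym 'g free_alg = "'g fmonoid \<Rightarrow>\<^sub>0 complex"

definition fgen :: "'g \<Rightarrow> 'g free_alg" where
  "fgen x = Poly_Mapping.single (Word [x]) 1"

definition fscalar :: "complex \<Rightarrow> 'g free_alg" where
  "fscalar a = Poly_Mapping.single 0 a"

text \<open>The first two families of relations cut the free algebra on the set \<open>'g\<close> down to the tensor
  algebra of the vector space \<open>'g\<close>; the third family yields the enveloping algebra.\<close>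

definition uea_relations ::
  "(complex \<Rightarrow> 'g \<Rightarrow> 'g) \<Rightarrow> ('g \<Rightarrow> 'g \<Rightarrow> 'g) \<Rightarrow> 'g::ab_group_add free_alg set" where
  "uea_relations scale bracket =
     {fgen (x + y) - (fgen x + fgen y) | x y. True} \<union>
     {fgen (scale a x) - fscalar a * fgen x | a x. True} \<union>
     {fgen x * fgen y - fgen y * fgen x - fgen (bracket x y) | x y. True}"

definition U_sl2 :: "sl2 free_alg set ring" where
  "U_sl2 = ring_of_type_algebra Quot
     (Idl\<^bsub>ring_of_type_algebra\<^esub> (uea_relations sl2_scale sl2_bracket))"

definition U_class :: "sl2 free_alg \<Rightarrow> sl2 free_alg set" where
  "U_class p = (Idl\<^bsub>ring_of_type_algebra\<^esub> (uea_relations sl2_scale sl2_bracket))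
     +>\<^bsub>ring_of_type_algebra\<^esub> p"

definition U_gen :: "sl2 \<Rightarrow> sl2 free_alg set" where
  "U_gen x = U_class (fgen x)"

definition U_scalar :: "complex \<Rightarrow> sl2 free_alg set" where
  "U_scalar a = U_class (fscalar a)"

definition Casimir :: "sl2 free_alg set" where
  "Casimir = U_scalar 4 \<otimes>\<^bsub>U_sl2\<^esub>
     ((U_gen (sl2_L 0) \<ominus>\<^bsub>U_sl2\<^esub> U_scalar (1/2)) [^]\<^bsub>U_sl2\<^esub> (2::nat)
      \<ominus>\<^bsub>U_sl2\<^esub> U_gen (sl2_L (-1)) \<otimes>\<^bsub>U_sl2\<^esub> U_gen (sl2_L 1))"

definition Casimir_ideal :: "complex \<Rightarrow> sl2 free_alg set set" where
  "Casimir_ideal c = Idl\<^bsub>U_sl2\<^esub> {Casimir \<ominus>\<^bsub>U_sl2\<^esub> U_scalar ((2 * c + 1)\<^sup>2)}"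


section \<open>Differential operators\<close>

text \<open>The subfield \<open>C(z)\<close> of \<open>C((z))\<close>.\<close>

definition rational_fls :: "complex fls set" where
  "rational_fls = {fps_to_fls (fps_of_poly p) / fps_to_fls (fps_of_poly q) | p q. q \<noteq> 0}"

text \<open>Operators with coefficients in \<open>C(z)\<close> are regarded as operators on \<open>C((z))\<close>, so that
  \<open>Diff(C(z))\<close> is literally a subset of \<open>Diff(C((z)))\<close>.\<close>

type_synonym operator = "complex fls \<Rightarrow> complex fls"

definition diff_op :: "(nat \<Rightarrow> complex fls) \<Rightarrow> nat \<Rightarrow> operator" where
  "diff_op \<xi> k = (\<lambda>f. \<Sum>j\<le>k. \<xi> j * (fls_deriv ^^ j) f)"

definition Diff :: "complex fls set \<Rightarrow> operator set" where
  "Diff V = {diff_op \<xi> k | \<xi> k. \<forall>j. \<xi> j \<in> V}"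

definition has_order :: "operator \<Rightarrow> nat \<Rightarrow> bool" where
  "has_order D k \<longleftrightarrow> (\<exists>\<xi>. D = diff_op \<xi> k \<and> \<xi> k \<noteq> 0)"

definition Diff_ring :: "complex fls set \<Rightarrow> operator ring" where
  "Diff_ring V = \<lparr>carrier = Diff V, monoid.mult = (\<lambda>D E. D \<circ> E), one = id,
     ring.zero = (\<lambda>f. 0), add = (\<lambda>D E f. D f + E f)\<rparr>"

definition scalar_op :: "complex \<Rightarrow> operator" where
  "scalar_op a = (\<lambda>f. fls_const a * f)"


section \<open>Representations of sl(2) by differential operators\<close>

definition lie_hom_Diff :: "complex fls set \<Rightarrow> (sl2 \<Rightarrow> operator) \<Rightarrow> bool" where
  "lie_hom_Diff V \<rho> \<longleftrightarrow>
     (\<forall>x. \<rho> x \<in> Diff V) \<and>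
     (\<forall>x y. \<rho> (x + y) = (\<lambda>f. \<rho> x f + \<rho> y f)) \<and>
     (\<forall>a x. \<rho> (sl2_scale a x) = scalar_op a \<circ> \<rho> x) \<and>
     (\<forall>x y. \<rho> (sl2_bracket x y) = (\<lambda>f. \<rho> x (\<rho> y f) - \<rho> y (\<rho> x f)))"

definition S_rep :: "complex fls set \<Rightarrow> (sl2 \<Rightarrow> operator) set" where
  "S_rep V = {\<rho>. lie_hom_Diff V \<rho> \<and> has_order (\<rho> (sl2_L 0)) 1}"

definition S_rep_ord :: "complex fls set \<Rightarrow> nat \<Rightarrow> (sl2 \<Rightarrow> operator) set" where
  "S_rep_ord V i = {\<rho> \<in> S_rep V. has_order (\<rho> (sl2_L (-1))) i}"

definition C_sl :: "complex set" where
  "C_sl = {\<mu>. Re \<mu> = -1/2 \<and> Im \<mu> \<ge> 0} \<union> {\<mu>. Re \<mu> > -1/2}"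

definition S0_formulas ::
  "(sl2 \<Rightarrow> operator) \<Rightarrow> complex fls \<Rightarrow> complex fls \<Rightarrow> complex \<Rightarrow> bool" where
  "S0_formulas \<rho> h b c \<longleftrightarrow>
     \<rho> (sl2_L (-1)) = (\<lambda>f. inverse h * f) \<and>
     \<rho> (sl2_L 0) = (\<lambda>f. - (h / fls_deriv h) * fls_deriv f + b * f) \<and>
     \<rho> (sl2_L 1) = (\<lambda>f. h * (\<rho> (sl2_L 0) (\<rho> (sl2_L 0) f) - \<rho> (sl2_L 0) f
                            - fls_const (c * (c + 1)) * f))"

definition S1_formulas ::
  "(sl2 \<Rightarrow> operator) \<Rightarrow> complex fls \<Rightarrow> complex fls \<Rightarrow> complex \<Rightarrow> bool" where
  "S1_formulas \<rho> h b c \<longleftrightarrow>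
     (\<forall>i\<in>{-1, 0, 1}. \<rho> (sl2_L i) =
        (\<lambda>f. - (h powi (i + 1) / fls_deriv h) * fls_deriv f
              + (b + of_int i * fls_const c) * h powi i * f))"

definition S2_formulas ::
  "(sl2 \<Rightarrow> operator) \<Rightarrow> complex fls \<Rightarrow> complex fls \<Rightarrow> complex \<Rightarrow> bool" where
  "S2_formulas \<rho> h b c \<longleftrightarrow>
     \<rho> (sl2_L (-1)) = (\<lambda>f. inverse h * (\<rho> (sl2_L 0) (\<rho> (sl2_L 0) f) + \<rho> (sl2_L 0) f
                                        - fls_const (c * (c + 1)) * f)) \<and>
     \<rho> (sl2_L 0) = (\<lambda>f. - (h / fls_deriv h) * fls_deriv f + b * f) \<and>
     \<rho> (sl2_L 1) = (\<lambda>f. h * f)"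

definition associated_triple ::
  "complex fls set \<Rightarrow> (sl2 \<Rightarrow> operator) \<Rightarrow> complex fls \<Rightarrow> complex fls \<Rightarrow> complex \<Rightarrow> bool" where
  "associated_triple V \<rho> h b c \<longleftrightarrow>
     h \<in> V \<and> b \<in> V \<and> fls_deriv h \<noteq> 0 \<and>
     (\<rho> \<in> S_rep_ord V 0 \<and> c \<in> C_sl \<and> S0_formulas \<rho> h b c \<or>
      \<rho> \<in> S_rep_ord V 1 \<and> S1_formulas \<rho> h b c \<or>
      \<rho> \<in> S_rep_ord V 2 \<and> c \<in> C_sl \<and> S2_formulas \<rho> h b c)"

end

theory Submission
  imports Defs
begin

text \<open>
  Write \<open>E\<close>, \<open>A\<close>, \<open>F\<close> for the generators \<open>L\<^sub>-\<^sub>1\<close>, \<open>L\<^sub>0\<close>, \<open>L\<^sub>1\<close>. Once the Casimir element is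
  specialised to \<open>(2c + 1)\<^sup>2\<close>, both products \<open>EF\<close> and \<open>FE\<close> become polynomials in \<open>A\<close>: \<open>EF = q(A)\<close> with
  \<open>q(x) = x\<^sup>2 - x - c(c + 1)\<close>, and \<open>FE = q(A + 1)\<close>. Together with \<open>EA = (A - 1)E\<close> and \<open>FA = (A + 1)F\<close>
  this presents the quotient as a generalized Weyl algebra. Two facts about such algebras give the
  theorem.

  The first is a normal form: every element is a finite sum of terms \<open>p\<^sub>n(A) e\<^sub>n\<close>, \<open>n \<in> \<int>\<close>, where \<open>e\<^sub>n\<close>
  is \<open>E\<^sup>n\<close> for \<open>n \<ge> 0\<close> and a power of \<open>F\<close> for \<open>n < 0\<close>. Indeed the elements that have a normal form
  are closed under left multiplication by the generators.

  The second is that the normal form is unique in any quotient where \<open>A\<close> stays transcendental over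
  the complex numbers (\<open>normal_form_unique\<close>). The term with index \<open>n\<close> is an eigenvector of
  \<open>[A, -]\<close> with eigenvalue \<open>n\<close>, so a vanishing sum has vanishing terms. If \<open>p(A) E\<^sup>n = 0\<close>, multiply
  on the right by \<open>F\<^sup>n\<close>: since \<open>q \<noteq> 0\<close>, one has \<open>E\<^sup>n F\<^sup>n = r(A)\<close> with \<open>r \<noteq> 0\<close>; this gives \<open>(p r)(A) = 0\<close>, hence \<open>p = 0\<close>.

  It remains to see that \<open>\<rho>\<close> respects the Casimir relation and that \<open>\<rho>(A)\<close> is transcendental.
  In each of the three families of representations a computation shows
  \<open>\<rho>(E) \<rho>(F) = q(\<rho>(A))\<close> (\<open>associated_triple_EF\<close>), and multiplication by the function \<open>h\<close> satisfies
  \<open>\<rho>(A) h = h (\<rho>(A) - 1)\<close> (\<open>associated_triple_shift\<close>). By the latter, if \<open>p\<close> annihilates \<open>\<rho>(A)\<close>, so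
  does \<open>p(x - 1)\<close>. A nonzero annihilating \<open>p\<close> of least degree would therefore be invariant under the
  shift, hence constant, which is absurd (\<open>ev_mem_imp_0\<close>).

  Everything is done in the free algebra, where the quotients are compared through
  congruences modulo two ideals: the kernel of the projection onto the central quotient, and the
  larger kernel of the action on Laurent series. Injectivity says that the two ideals coincide.\<close>

section \<open>Algebras over the complex numbers and congruences modulo an ideal\<close>

locale complex_algebra =
  fixes s :: "complex \<Rightarrow> 'a::ring_1"
  assumes s_one: "s 1 = 1"
    and s_add: "s (x + y) = s x + s y"
    and s_mult: "s (x * y) = s x * s y"
    and s_central: "u * s x = s x * u"
begin

lemma s_zero: "s 0 = 0"
  using s_add[of 0 0] by simp

lemma s_minus: "s (- x) = - s x"
  using s_add[of x "- x"] by (simp add: s_zero eq_neg_iff_add_eq_0 add.commute)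

lemma s_diff: "s (x - y) = s x - s y"
  using s_add[of x "- y"] by (simp add: s_minus)

lemma s_central_left: "u * (s x * v) = s x * (u * v)"
  by (metis mult.assoc s_central)

text \<open>Horner's scheme in a noncommutative algebra. Evaluation is still multiplicative, because the
  coefficients are central.\<close>

definition ev :: "'a \<Rightarrow> complex poly \<Rightarrow> 'a" where
  "ev a p = fold_coeffs (\<lambda>x u. s x + a * u) p 0"

lemma ev_0: "ev a 0 = 0"
  by (simp add: ev_def)

lemma ev_pCons: "ev a (pCons x p) = s x + a * ev a p"
  by (cases "p = 0 \<and> x = 0") (auto simp: ev_def s_zero)

lemma ev_const: "ev a [:x:] = s x"
  by (simp add: ev_pCons ev_0)

lemma ev_linear: "ev a [:x, 1:] = a + s x"
  by (simp add: ev_pCons ev_0 s_one add.commute)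

lemma ev_1: "ev a 1 = 1"
  using ev_const[of a 1] by (simp add: s_one one_pCons)

lemma ev_add: "ev a (p + q) = ev a p + ev a q"
  by (induction p q rule: poly_induct2) (simp_all add: ev_0 ev_pCons s_add algebra_simps)

lemma ev_smult: "ev a (smult x p) = s x * ev a p"
  by (induction p) (simp_all add: ev_0 ev_pCons s_mult algebra_simps s_central_left s_central[of "s x"])

lemma ev_mult: "ev a (p * q) = ev a p * ev a q"
proof (induction p)
  case (pCons x p)
  then show ?case
    by (simp add: ev_pCons ev_add ev_smult s_zero distrib_right mult.assoc)
qed (simp add: ev_0)

lemma ev_commute: "a * ev a p = ev a p * a"
  using ev_mult[of a "[:0, 1:]" p] ev_mult[of a p "[:0, 1:]"]
  by (simp add: ev_linear s_zero mult.commute)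

end

text \<open>The quotient by \<open>J\<close> varies with the parameter \<open>c\<close> and so cannot be a type; computations in it are
  carried out as congruences between representatives.\<close>

locale ideal_congruence = complex_algebra s for s :: "complex \<Rightarrow> 'a::ring_1" +
  fixes J :: "'a set"
  assumes J_zero: "0 \<in> J"
    and J_add: "u \<in> J \<Longrightarrow> v \<in> J \<Longrightarrow> u + v \<in> J"
    and J_left: "u \<in> J \<Longrightarrow> w * u \<in> J"
    and J_right: "u \<in> J \<Longrightarrow> u * w \<in> J"
begin

definition cong (infix "\<asymp>" 50) where
  "u \<asymp> v \<longleftrightarrow> u - v \<in> J"

lemma J_minus: "u \<in> J \<Longrightarrow> - u \<in> J"
  using J_left[of u "- 1"] by simp

lemma J_diff: "u \<in> J \<Longrightarrow> v \<in> J \<Longrightarrow> u - v \<in> J"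
  using J_add[of u "- v"] J_minus[of v] by simp

lemma cong_refl [simp]: "u \<asymp> u"
  by (simp add: cong_def J_zero)

lemma cong_trans [trans]: "u \<asymp> v \<Longrightarrow> v \<asymp> w \<Longrightarrow> u \<asymp> w"
  using J_add[of "u - v" "v - w"] by (simp add: cong_def)

lemma cong_add: "u \<asymp> u' \<Longrightarrow> v \<asymp> v' \<Longrightarrow> u + v \<asymp> u' + v'"
  using J_add[of "u - u'" "v - v'"] by (simp add: cong_def algebra_simps)

lemma cong_diff: "u \<asymp> u' \<Longrightarrow> v \<asymp> v' \<Longrightarrow> u - v \<asymp> u' - v'"
  using J_diff[of "u - u'" "v - v'"] by (simp add: cong_def algebra_simps)

lemma cong_left: "u \<asymp> v \<Longrightarrow> w * u \<asymp> w * v"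
  using J_left[of "u - v" w] by (simp add: cong_def algebra_simps)

lemma cong_right: "u \<asymp> v \<Longrightarrow> u * w \<asymp> v * w"
  using J_right[of "u - v" w] by (simp add: cong_def algebra_simps)

lemma cong_sum: "(\<And>n. n \<in> S \<Longrightarrow> f n \<asymp> g n) \<Longrightarrow> sum f S \<asymp> sum g S"
  by (induction S rule: infinite_finite_induct) (simp_all add: cong_add)

lemma J_sum: "(\<And>n. n \<in> S \<Longrightarrow> f n \<in> J) \<Longrightarrow> sum f S \<in> J"
  by (induction S rule: infinite_finite_induct) (simp_all add: J_zero J_add)

lemma cong_mem: "u \<asymp> v \<Longrightarrow> u \<in> J \<longleftrightarrow> v \<in> J"
  using J_add[of "u - v" v] J_diff[of u "u - v"] by (auto simp: cong_def)

lemma cong_0: "u \<asymp> 0 \<longleftrightarrow> u \<in> J"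
  by (simp add: cong_def)

lemma scalar_cancel:
  assumes "x \<noteq> 0" "s x * u \<in> J" shows "u \<in> J"
proof -
  have "s (inverse x) * (s x * u) = u"
    using assms(1) by (simp add: mult.assoc[symmetric] s_mult[symmetric] s_one)
  then show ?thesis using J_left[OF assms(2), of "s (inverse x)"] by simp
qed

text \<open>Moving an element of weight \<open>- d\<close> past a polynomial in \<open>a\<close> shifts the argument of the polynomial.\<close>

lemma ev_shift:
  assumes "x * a \<asymp> (a + s d) * x"
  shows "x * ev a p \<asymp> ev a (p \<circ>\<^sub>p [:d, 1:]) * x"
proof (induction p)
  case (pCons r p)
  have "x * ev a (pCons r p) = s r * x + (x * a) * ev a p"
    by (simp add: ev_pCons algebra_simps s_central)
  also have "\<dots> \<asymp> s r * x + (a + s d) * x * ev a p"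
    by (intro cong_add cong_right cong_refl assms)
  also have "(a + s d) * x * ev a p = (a + s d) * (x * ev a p)"
    by (simp add: mult.assoc)
  also have "s r * x + \<dots> \<asymp> s r * x + (a + s d) * (ev a (p \<circ>\<^sub>p [:d, 1:]) * x)"
    by (intro cong_add cong_left cong_refl pCons.IH)
  also have "\<dots> = ev a (pCons r p \<circ>\<^sub>p [:d, 1:]) * x"
    by (simp only: pcompose_pCons ev_add ev_mult ev_const ev_linear) (simp add: algebra_simps)
  finally show ?case .
qed (simp add: ev_0)

text \<open>Eigenvectors of \<open>[a, -]\<close> with distinct eigenvalues are linearly independent modulo \<open>J\<close>.
  As usual, applying \<open>[a, -] - m\<close> to the sum kills the term with eigenvalue \<open>m\<close> and only
  rescales the others by the nonzero scalars \<open>n - m\<close>.\<close>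

lemma weight_components:
  assumes "finite S"
    and "\<And>n. n \<in> S \<Longrightarrow> a * t n - t n * a \<asymp> s (of_int n) * t n"
    and "(\<Sum>n\<in>S. t n) \<in> J"
  shows "\<forall>n\<in>S. t n \<in> J"
  using assms
proof (induction S arbitrary: t rule: finite_induct)
  case (insert m S)
  let ?u = "\<Sum>n\<in>insert m S. t n"
  have fin: "finite (insert m S)" using insert.hyps by simp
  have "a * ?u - ?u * a - s (of_int m) * ?u
      = (\<Sum>n\<in>insert m S. a * t n - t n * a - s (of_int m) * t n)"
    by (simp only: sum_distrib_left sum_distrib_right sum_subtractf)
  also have "\<dots> \<asymp> (\<Sum>n\<in>insert m S. s (of_int n) * t n - s (of_int m) * t n)"
    by (intro cong_sum cong_diff cong_refl insert.prems)
  also have "\<dots> = (\<Sum>n\<in>insert m S. s (of_int (n - m)) * t n)"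
    by (simp only: of_int_diff s_diff left_diff_distrib)
  also have "\<dots> = (\<Sum>n\<in>S. s (of_int (n - m)) * t n)"
    using insert.hyps by (simp add: s_zero)
  finally have "(\<Sum>n\<in>S. s (of_int (n - m)) * t n) \<in> J"
    by (rule iffD1[OF cong_mem]) (intro J_diff J_left J_right insert.prems)
  moreover have "a * (s (of_int (n - m)) * t n) - s (of_int (n - m)) * t n * a
      \<asymp> s (of_int n) * (s (of_int (n - m)) * t n)" if "n \<in> S" for n
  proof -
    have "a * (s (of_int (n - m)) * t n) - s (of_int (n - m)) * t n * a
        = s (of_int (n - m)) * (a * t n - t n * a)"
      by (simp only: right_diff_distrib mult.assoc s_central_left[of a])
    also have "\<dots> \<asymp> s (of_int (n - m)) * (s (of_int n) * t n)"
      using that by (intro cong_left insert.prems) simp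
    also have "\<dots> = s (of_int n) * (s (of_int (n - m)) * t n)"
      by (rule s_central_left)
    finally show ?thesis .
  qed
  ultimately have "\<forall>n\<in>S. s (of_int (n - m)) * t n \<in> J"
    using insert.IH[of "\<lambda>n. s (of_int (n - m)) * t n"] by blast
  then have S: "\<forall>n\<in>S. t n \<in> J"
    using insert.hyps by (metis scalar_cancel of_int_eq_0_iff eq_iff_diff_eq_0)
  then have "(\<Sum>n\<in>S. t n) \<in> J"
    by (simp add: J_sum)
  then have "t m \<in> J"
    using insert.prems(2) insert.hyps J_diff[of ?u "\<Sum>n\<in>S. t n"] by simp
  with S show ?case by simp
qed simp

end

section \<open>Generalized Weyl algebras\<close>

lemma shift_eq_0_iff: "p \<circ>\<^sub>p [:d, 1:] = 0 \<longleftrightarrow> p = 0" for p :: "complex poly"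
  using pcompose_eq_0[of p "[:d, 1:]"] by auto

text \<open>The relations, modulo \<open>J\<close>, of the generalized Weyl algebra over the polynomial ring in \<open>a\<close> that belongs
  to the automorphism \<open>a \<mapsto> a + 1\<close> and the polynomial \<open>q\<close>. For \<open>q = x\<^sup>2 - x - c(c + 1)\<close> it is a central
  quotient of the enveloping algebra of sl(2).\<close>

locale weyl_relations = ideal_congruence s J for s :: "complex \<Rightarrow> 'a::ring_1" and J :: "'a set" +
  fixes a E F :: 'a and q :: "complex poly"
  assumes Ea_mem: "E * a - (a + s (- 1)) * E \<in> J"
    and Fa_mem: "F * a - (a + s 1) * F \<in> J"
    and EF_mem: "E * F - complex_algebra.ev s a q \<in> J"
    and FE_mem: "F * E - complex_algebra.ev s a (q \<circ>\<^sub>p [:1, 1:]) \<in> J"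
begin

lemma Ea: "E * a \<asymp> (a + s (- 1)) * E"
  and Fa: "F * a \<asymp> (a + s 1) * F"
  and EF: "E * F \<asymp> ev a q"
  and FE: "F * E \<asymp> ev a (q \<circ>\<^sub>p [:1, 1:])"
  using Ea_mem Fa_mem EF_mem FE_mem by (simp_all add: cong_def)

definition basis :: "int \<Rightarrow> 'a" where
  "basis n = (if 0 \<le> n then E ^ nat n else F ^ nat (- n))"

definition has_normal_form :: "'a \<Rightarrow> bool" where
  "has_normal_form u \<longleftrightarrow> (\<exists>S P. finite S \<and> u \<asymp> (\<Sum>n\<in>S. ev a (P n) * basis n))"

lemma has_normal_form_cong: "u \<asymp> v \<Longrightarrow> has_normal_form v \<Longrightarrow> has_normal_form u"
  unfolding has_normal_form_def by (meson cong_trans)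

lemma has_normal_form_term: "has_normal_form (ev a p * basis n)"
  unfolding has_normal_form_def by (intro exI[of _ "{n}"] exI[of _ "\<lambda>_. p"]) simp

lemma has_normal_form_0: "has_normal_form 0"
  unfolding has_normal_form_def by (intro exI[of _ "{}"]) simp

lemma has_normal_form_add:
  assumes "has_normal_form u" "has_normal_form v" shows "has_normal_form (u + v)"
proof -
  obtain S P where S: "finite S" and u: "u \<asymp> (\<Sum>n\<in>S. ev a (P n) * basis n)"
    using assms(1) by (auto simp: has_normal_form_def)
  obtain T Q where T: "finite T" and v: "v \<asymp> (\<Sum>n\<in>T. ev a (Q n) * basis n)"
    using assms(2) by (auto simp: has_normal_form_def)
  define R where "R n = (if n \<in> S then P n else 0) + (if n \<in> T then Q n else 0)" for n
  have eS: "(\<Sum>n\<in>S. ev a (P n) * basis n) = (\<Sum>n\<in>S \<union> T. ev a (if n \<in> S then P n else 0) * basis n)"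
    using S T by (intro sum.mono_neutral_cong_left) (auto simp: ev_0)
  have eT: "(\<Sum>n\<in>T. ev a (Q n) * basis n) = (\<Sum>n\<in>S \<union> T. ev a (if n \<in> T then Q n else 0) * basis n)"
    using S T by (intro sum.mono_neutral_cong_left) (auto simp: ev_0)
  have "u + v \<asymp> (\<Sum>n\<in>S \<union> T. ev a (R n) * basis n)"
    using cong_add[OF u v] by (simp add: eS eT R_def ev_add distrib_right sum.distrib)
  then show ?thesis
    unfolding has_normal_form_def using S T by (meson finite_UnI)
qed

lemma has_normal_form_sum: "(\<And>n. n \<in> S \<Longrightarrow> has_normal_form (f n)) \<Longrightarrow> has_normal_form (sum f S)"
  by (induction S rule: infinite_finite_induct) (simp_all add: has_normal_form_0 has_normal_form_add)

lemma has_normal_form_left: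
  assumes "\<And>p n. has_normal_form (w * (ev a p * basis n))" and "has_normal_form u"
  shows "has_normal_form (w * u)"
proof -
  obtain S P where u: "u \<asymp> (\<Sum>n\<in>S. ev a (P n) * basis n)"
    using assms(2) by (auto simp: has_normal_form_def)
  have "w * u \<asymp> (\<Sum>n\<in>S. w * (ev a (P n) * basis n))"
    using cong_left[OF u, of w] by (simp add: sum_distrib_left)
  then show ?thesis
    by (rule has_normal_form_cong) (intro has_normal_form_sum assms(1))
qed

lemma has_normal_form_ev_left: "has_normal_form u \<Longrightarrow> has_normal_form (ev a r * u)"
  by (rule has_normal_form_left) (simp_all add: mult.assoc[symmetric] ev_mult[symmetric] has_normal_form_term)

lemma has_normal_form_scalar_left: "has_normal_form u \<Longrightarrow> has_normal_form (s x * u)"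
  using has_normal_form_ev_left[of u "[:x:]"] by (simp add: ev_const)

lemma has_normal_form_a_left: "has_normal_form u \<Longrightarrow> has_normal_form (a * u)"
  using has_normal_form_ev_left[of u "[:0, 1:]"] by (simp add: ev_linear s_zero)

lemma basis_nonneg: "basis (int k) = E ^ k"
  by (simp add: basis_def)

lemma basis_nonpos: "basis (- int k) = F ^ k"
  by (simp add: basis_def)

lemma E_basis: "\<exists>r. E * basis n \<asymp> ev a r * basis (n + 1)"
proof (cases "0 \<le> n")
  case True
  then obtain k where k: "n = int k" by (rule nonneg_int_cases)
  then have "E * basis n = basis (n + 1)"
    using basis_nonneg[of k] basis_nonneg[of "Suc k"] by (simp add: add.commute)
  then show ?thesis by (intro exI[of _ 1]) (simp add: ev_1)
next
  case False
  then obtain k where "n = - int (Suc k)" by (metis int_cases of_nat_0_le_iff)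
  then have "basis n = F * basis (n + 1)"
    using basis_nonpos[of k] basis_nonpos[of "Suc k"] by simp
  then have "E * basis n \<asymp> ev a q * basis (n + 1)"
    using cong_right[OF EF, of "basis (n + 1)"] by (simp add: mult.assoc)
  then show ?thesis by blast
qed

lemma F_basis: "\<exists>r. F * basis n \<asymp> ev a r * basis (n - 1)"
proof (cases "n \<le> 0")
  case True
  then obtain k where k: "n = - int k" by (rule nonpos_int_cases)
  then have "n - 1 = - int (Suc k)" by simp
  then have "F * basis n = basis (n - 1)"
    using k by (simp only: basis_nonpos power_Suc)
  then show ?thesis by (intro exI[of _ 1]) (simp add: ev_1)
next
  case False
  then obtain k where "n = int (Suc k)" by (metis not_le pos_int_cases Suc_pred)
  then have "basis n = E * basis (n - 1)"
    using basis_nonneg[of k] basis_nonneg[of "Suc k"] by simp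
  then have "F * basis n \<asymp> ev a (q \<circ>\<^sub>p [:1, 1:]) * basis (n - 1)"
    using cong_right[OF FE, of "basis (n - 1)"] by (simp add: mult.assoc)
  then show ?thesis by blast
qed

text \<open>The case \<open>d = - 1\<close> is left multiplication by \<open>E\<close>, and \<open>d = 1\<close> is left multiplication by \<open>F\<close>.\<close>

lemma has_normal_form_shift_left:
  assumes "w * a \<asymp> (a + s d) * w" and "\<And>n. \<exists>r m. w * basis n \<asymp> ev a r * basis m" and "has_normal_form u"
  shows "has_normal_form (w * u)"
proof (rule has_normal_form_left)
  fix p n
  obtain r m where rm: "w * basis n \<asymp> ev a r * basis m"
    using assms(2) by blast
  have "w * (ev a p * basis n) = (w * ev a p) * basis n"
    by (simp add: mult.assoc)
  also have "\<dots> \<asymp> ev a (p \<circ>\<^sub>p [:d, 1:]) * w * basis n"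
    by (intro cong_right ev_shift assms(1))
  also have "\<dots> = ev a (p \<circ>\<^sub>p [:d, 1:]) * (w * basis n)"
    by (simp add: mult.assoc)
  also have "\<dots> \<asymp> ev a (p \<circ>\<^sub>p [:d, 1:]) * (ev a r * basis m)"
    by (intro cong_left rm)
  also have "\<dots> = ev a (p \<circ>\<^sub>p [:d, 1:] * r) * basis m"
    by (simp add: ev_mult mult.assoc)
  finally show "has_normal_form (w * (ev a p * basis n))"
    using has_normal_form_cong has_normal_form_term by blast
qed (fact assms(3))

lemma has_normal_form_E_left: "has_normal_form u \<Longrightarrow> has_normal_form (E * u)"
  by (rule has_normal_form_shift_left[OF Ea]) (use E_basis in blast)

lemma has_normal_form_F_left: "has_normal_form u \<Longrightarrow> has_normal_form (F * u)"
  by (rule has_normal_form_shift_left[OF Fa]) (use F_basis in blast)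

lemma power_shift:
  assumes "w * a \<asymp> (a + s d) * w"
  shows "w ^ k * a \<asymp> (a + s (of_nat k * d)) * w ^ k"
proof (induction k)
  case (Suc k)
  have "w ^ Suc k * a = w * (w ^ k * a)" by (simp add: mult.assoc)
  also have "\<dots> \<asymp> w * ((a + s (of_nat k * d)) * w ^ k)"
    by (intro cong_left Suc.IH)
  also have "\<dots> = (w * a + s (of_nat k * d) * w) * w ^ k"
    by (simp add: algebra_simps s_central s_central_left)
  also have "\<dots> \<asymp> ((a + s d) * w + s (of_nat k * d) * w) * w ^ k"
    by (intro cong_right cong_add assms cong_refl)
  also have "\<dots> = (a + s (of_nat (Suc k) * d)) * w ^ Suc k"
    by (simp add: algebra_simps s_add)
  finally show ?case .
qed (simp add: s_zero)

text \<open>The normal form terms are the weight vectors to which \<open>weight_components\<close> applies.\<close>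

lemma basis_weight: "a * (ev a p * basis n) - ev a p * basis n * a \<asymp> s (of_int n) * (ev a p * basis n)"
proof -
  have "basis n * a \<asymp> (a + s (- of_int n)) * basis n"
    using power_shift[OF Ea, of "nat n"] power_shift[OF Fa, of "nat (- n)"]
    by (auto simp: basis_def)
  from cong_left[OF this, of "ev a p"]
  have "a * (ev a p * basis n) - ev a p * (basis n * a)
      \<asymp> a * (ev a p * basis n) - ev a p * ((a + s (- of_int n)) * basis n)"
    by (intro cong_diff cong_refl)
  also have "\<dots> = s (of_int n) * (ev a p * basis n)"
    by (simp add: s_minus algebra_simps s_central_left)
       (metis ev_commute mult.assoc)
  finally show ?thesis by (simp add: mult.assoc)
qed

text \<open>If \<open>w w'\<close> is a nonzero polynomial in \<open>a\<close>, then \<open>w\<^sup>k w'\<^sup>k = w (w\<^sup>k\<^sup>-\<^sup>1 w'\<^sup>k\<^sup>-\<^sup>1) w'\<close> is a product of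
  shifts of that polynomial, and shifts do not vanish.\<close>

lemma power_product:
  assumes "w * a \<asymp> (a + s d) * w" and "w * w' \<asymp> ev a r" and "r \<noteq> 0"
  shows "\<exists>p. p \<noteq> 0 \<and> w ^ k * w' ^ k \<asymp> ev a p"
proof (induction k)
  case 0
  show ?case by (intro exI[of _ 1]) (simp add: ev_1)
next
  case (Suc k)
  then obtain p where p: "p \<noteq> 0" "w ^ k * w' ^ k \<asymp> ev a p" by blast
  have "w ^ Suc k * w' ^ Suc k = w * (w ^ k * w' ^ k) * w'"
    by (simp add: mult.assoc power_commutes)
  also have "\<dots> \<asymp> w * ev a p * w'"
    by (intro cong_right cong_left p)
  also have "\<dots> \<asymp> ev a (p \<circ>\<^sub>p [:d, 1:]) * w * w'"
    by (intro cong_right ev_shift assms)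
  also have "\<dots> = ev a (p \<circ>\<^sub>p [:d, 1:]) * (w * w')"
    by (simp add: mult.assoc)
  also have "\<dots> \<asymp> ev a (p \<circ>\<^sub>p [:d, 1:]) * ev a r"
    by (intro cong_left assms)
  finally have "w ^ Suc k * w' ^ Suc k \<asymp> ev a (p \<circ>\<^sub>p [:d, 1:] * r)"
    by (simp add: ev_mult)
  moreover have "p \<circ>\<^sub>p [:d, 1:] * r \<noteq> 0"
    using p(1) assms(3) by (simp add: shift_eq_0_iff)
  ultimately show ?case by blast
qed

text \<open>A power of \<open>E\<close> or \<open>F\<close> is not a zero divisor against polynomials in \<open>a\<close>, because the opposite power
  turns it into a nonzero polynomial in \<open>a\<close>, and \<open>a\<close> is transcendental modulo \<open>J\<close>.\<close>

lemma term_eq_0: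
  assumes "q \<noteq> 0" and trans: "\<And>p. ev a p \<in> J \<Longrightarrow> p = 0" and t: "ev a p * basis n \<in> J"
  shows "p = 0"
proof -
  have "q \<circ>\<^sub>p [:1, 1:] \<noteq> 0"
    using \<open>q \<noteq> 0\<close> by (simp add: shift_eq_0_iff)
  then obtain w r where r: "r \<noteq> 0" "basis n * w \<asymp> ev a r"
    using power_product[OF Ea EF \<open>q \<noteq> 0\<close>, of "nat n"] power_product[OF Fa FE, of "nat (- n)"]
    unfolding basis_def by (cases "0 \<le> n") (simp_all, blast+)
  have "ev a p * basis n * w \<in> J" using t by (rule J_right)
  then have "ev a (p * r) \<in> J"
    using cong_mem[OF cong_left[OF r(2), of "ev a p"]] by (simp add: ev_mult mult.assoc)
  then show ?thesis using trans r(1) by fastforce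
qed

theorem normal_form_unique:
  assumes "q \<noteq> 0" and "\<And>p. ev a p \<in> J \<Longrightarrow> p = 0"
    and "finite S" and "(\<Sum>n\<in>S. ev a (P n) * basis n) \<in> J"
  shows "\<forall>n\<in>S. P n = 0"
  using weight_components[of S a "\<lambda>n. ev a (P n) * basis n", OF assms(3) basis_weight assms(4)]
    term_eq_0[OF assms(1,2)] by blast

end

text \<open>Such a polynomial takes the value \<open>p(0)\<close> at all the points \<open>0, -1, -2, \<dots>\<close>.\<close>

lemma pcompose_shift_invariant:
  fixes p :: "complex poly"
  assumes "p \<circ>\<^sub>p [:-1, 1:] = p"
  obtains x where "p = [:x:]"
proof -
  have step: "poly p (z - 1) = poly p z" for z
    using arg_cong[OF assms, of "\<lambda>p. poly p z"] by (simp add: poly_pcompose)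
  have "poly p (- of_nat n) = poly p 0" for n
  proof (induction n)
    case (Suc n)
    have "- of_nat (Suc n) = - of_nat n - (1 :: complex)" by simp
    then show ?case using Suc step by metis
  qed simp
  then have "range (\<lambda>n. - of_nat n) \<subseteq> {z. poly (p - [:poly p 0:]) z = 0}"
    by auto
  moreover have "infinite (range (\<lambda>n. - of_nat n :: complex))"
    by (intro range_inj_infinite) (simp add: inj_on_def)
  ultimately have "p - [:poly p 0:] = 0"
    using poly_roots_finite finite_subset by blast
  then show ?thesis using that by auto
qed

text \<open>The polynomials \<open>p\<close> with \<open>p(a) \<in> J\<close> form a proper ideal stable under \<open>x \<mapsto> x - 1\<close>. Subtracting \<open>p\<close>
  from its shift lowers the degree, so by descent a nonzero \<open>p\<close> would lead to a nonzero constant in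
  the ideal.\<close>

lemma (in ideal_congruence) ev_mem_imp_0:
  assumes "1 \<notin> J" and shift: "\<And>p. ev a p \<in> J \<Longrightarrow> ev a (p \<circ>\<^sub>p [:-1, 1:]) \<in> J"
    and "ev a p \<in> J"
  shows "p = 0"
  using assms(3)
proof (induction "degree p" arbitrary: p rule: less_induct)
  case less
  let ?d = "p \<circ>\<^sub>p [:-1, 1:] - p"
  have "ev a ?d \<in> J"
    using J_diff[OF shift[OF less.prems] less.prems] ev_add[of a ?d p] by simp
  have lc: "lead_coeff (p \<circ>\<^sub>p [:-1, 1:]) = lead_coeff p"
    by (subst lead_coeff_comp) auto
  have "degree (p \<circ>\<^sub>p [:-1, 1:]) = degree p"
    by (simp add: degree_pcompose)
  with lc have cf: "coeff ?d (degree p) = 0" by simp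
  have le: "degree ?d \<le> degree p"
    by (intro degree_diff_le) (simp_all add: degree_pcompose)
  show ?case
  proof (cases "degree p = 0")
    case True
    then obtain x where x: "p = [:x:]" by (metis degree_eq_zeroE)
    then have "s x * 1 \<in> J" using less.prems by (simp add: ev_const)
    then show ?thesis using assms(1) scalar_cancel x by (metis pCons_0_0)
  next
    case False
    then have "degree ?d < degree p"
      using cf le by (metis degree_0 eq_zero_or_degree_less le_eq_less_or_eq)
    then have "?d = 0" using less.hyps \<open>ev a ?d \<in> J\<close> by blast
    then have "p \<circ>\<^sub>p [:-1, 1:] = p" by simp
    then obtain x where "p = [:x:]" by (rule pcompose_shift_invariant)
    with False show ?thesis by simp
  qed
qed

text \<open>The injectivity criterion: an ideal \<open>K\<close> above \<open>J\<close> modulo which \<open>a\<close> stays transcendental contains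
  no normal form but \<open>0\<close>, so an element of \<open>K\<close> is congruent to \<open>0\<close> modulo \<open>J\<close> once it has a normal form
  modulo \<open>J\<close>. Stability of \<open>K\<close> under the shift of polynomials provides the transcendence.\<close>

theorem (in weyl_relations) larger_kernel_mem:
  assumes "ideal_congruence s K" and "J \<subseteq> K" and "1 \<notin> K"
    and "\<And>p. ev a p \<in> K \<Longrightarrow> ev a (p \<circ>\<^sub>p [:-1, 1:]) \<in> K"
    and "q \<noteq> 0" and "has_normal_form u" and "u \<in> K"
  shows "u \<in> J"
proof -
  interpret K: ideal_congruence s K by fact
  interpret K: weyl_relations s K a E F q
    by unfold_locales (rule subsetD[OF \<open>J \<subseteq> K\<close>], rule Ea_mem Fa_mem EF_mem FE_mem)+
  obtain S P where S: "finite S" and u: "u \<asymp> (\<Sum>n\<in>S. ev a (P n) * basis n)"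
    using \<open>has_normal_form u\<close> by (auto simp: has_normal_form_def)
  have "u - (\<Sum>n\<in>S. ev a (P n) * basis n) \<in> K"
    using u \<open>J \<subseteq> K\<close> by (auto simp: cong_def)
  then have "(\<Sum>n\<in>S. ev a (P n) * basis n) \<in> K"
    using \<open>u \<in> K\<close> K.J_diff[of u "u - (\<Sum>n\<in>S. ev a (P n) * basis n)"] by simp
  then have "\<forall>n\<in>S. P n = 0"
    by (intro K.normal_form_unique[OF \<open>q \<noteq> 0\<close> K.ev_mem_imp_0[OF assms(3,4)] S])
  then have "(\<Sum>n\<in>S. ev a (P n) * basis n) = 0"
    by (intro sum.neutral) (simp add: ev_0)
  with u show ?thesis by (simp add: cong_0)
qed

section \<open>The free algebra and its actions\<close>

lemma free_alg_induct [case_names single add]: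
  fixes p :: "'g free_alg"
  assumes "\<And>w c. P (Poly_Mapping.single w c)"
    and "\<And>p q. P p \<Longrightarrow> P q \<Longrightarrow> P (p + q)"
  shows "P p"
proof (induction p rule: update_induct)
  case const
  show ?case using assms(1)[of _ 0] by simp
next
  case (update f w c)
  have "Poly_Mapping.update w c f = Poly_Mapping.single w c + f"
    using update(1) by (intro poly_mapping_eqI)
      (auto simp: lookup_update lookup_add lookup_single in_keys_iff when_def)
  then show ?case using assms update(3) by simp
qed

lemma single_Cons:
  "Poly_Mapping.single (Word (x # xs)) c = fgen x * Poly_Mapping.single (Word xs) c"
  by (simp add: fgen_def mult_single)

lemma single_Nil: "Poly_Mapping.single (Word []) c = fscalar c"
  by (simp add: fscalar_def zero_fmonoid_def)

lemma fscalar_central: "p * fscalar c = fscalar c * p"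
  by (induction p rule: free_alg_induct)
    (simp_all add: fscalar_def mult_single mult.commute distrib_left distrib_right)

interpretation free_alg: complex_algebra "fscalar :: complex \<Rightarrow> 'g free_alg"
proof
  show "p * fscalar c = fscalar c * p" for p :: "'g free_alg" and c
    by (rule fscalar_central)
qed (simp_all add: fscalar_def single_add mult_single)

text \<open>Linearity over the constants only: a differential operator does not commute with multiplication
  by a Laurent series.\<close>

definition linear_op :: "operator \<Rightarrow> bool" where
  "linear_op D \<longleftrightarrow> (\<forall>f g. D (f + g) = D f + D g) \<and> (\<forall>c f. D (fls_const c * f) = fls_const c * D f)"

lemma linear_op_0: "linear_op D \<Longrightarrow> D 0 = 0"
  unfolding linear_op_def by (metis add_cancel_right_right)

fun word_act :: "('g \<Rightarrow> operator) \<Rightarrow> 'g fmonoid \<Rightarrow> operator" where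
  "word_act \<rho> (Word xs) f = foldr \<rho> xs f"

lemma word_act_0: "word_act \<rho> 0 f = f"
  by (simp add: zero_fmonoid_def)

lemma word_act_add: "word_act \<rho> (v + w) f = word_act \<rho> v (word_act \<rho> w f)"
  by (cases v; cases w) simp

definition act :: "('g \<Rightarrow> operator) \<Rightarrow> 'g free_alg \<Rightarrow> operator" where
  "act \<rho> p f = (\<Sum>w\<in>Poly_Mapping.keys p. fls_const (Poly_Mapping.lookup p w) * word_act \<rho> w f)"

lemma act_superset:
  assumes "finite A" "Poly_Mapping.keys p \<subseteq> A"
  shows "act \<rho> p f = (\<Sum>w\<in>A. fls_const (Poly_Mapping.lookup p w) * word_act \<rho> w f)"
  unfolding act_def using assms
  by (intro sum.mono_neutral_left) (auto simp: in_keys_iff)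

lemma act_single: "act \<rho> (Poly_Mapping.single w c) f = fls_const c * word_act \<rho> w f"
  by (simp add: act_superset[of "{w}"])

lemma act_add: "act \<rho> (p + q) f = act \<rho> p f + act \<rho> q f"
proof -
  let ?A = "Poly_Mapping.keys p \<union> Poly_Mapping.keys q"
  have "Poly_Mapping.keys (p + q) \<subseteq> ?A" by (rule Poly_Mapping.keys_add)
  then show ?thesis
    by (simp add: act_superset[of ?A] lookup_add distrib_right sum.distrib flip: fls_plus_const)
qed

lemma act_fscalar: "act \<rho> (fscalar c) = scalar_op c"
  by (simp add: fun_eq_iff fscalar_def act_single word_act_0 scalar_op_def)

lemma act_one: "act \<rho> 1 = id"
  using act_fscalar[of \<rho> 1] by (simp add: free_alg.s_one scalar_op_def fun_eq_iff)

lemma act_fgen: "act \<rho> (fgen x) = \<rho> x"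
  by (simp add: fun_eq_iff fgen_def act_single)

lemma act_0: "act \<rho> 0 f = 0"
  by (simp add: act_def)

lemma act_minus: "act \<rho> (- p) f = - act \<rho> p f"
  using act_add[of \<rho> p "- p" f] by (simp add: act_0 eq_neg_iff_add_eq_0 add.commute)

lemma act_diff: "act \<rho> (p - q) f = act \<rho> p f - act \<rho> q f"
  using act_add[of \<rho> p "- q" f] by (simp add: act_minus)

locale linear_action =
  fixes \<rho> :: "'g \<Rightarrow> operator"
  assumes linear: "linear_op (\<rho> x)"
begin

lemma linear_word_act: "linear_op (word_act \<rho> w)"
proof (cases w)
  case (Word xs)
  show ?thesis
    unfolding Word
    by (induction xs) (use linear in \<open>auto simp: linear_op_def\<close>)
qed

lemma act_linear: "linear_op (act \<rho> p)"
  using linear_word_act unfolding linear_op_def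
  by (auto simp: act_def sum.distrib algebra_simps sum_distrib_left)

lemma act_mult: "act \<rho> (p * q) f = act \<rho> p (act \<rho> q f)"
proof (induction p rule: free_alg_induct)
  case (single v c)
  show ?case
  proof (induction q rule: free_alg_induct)
    case (single w d)
    have "word_act \<rho> v (fls_const d * word_act \<rho> w f) = fls_const d * word_act \<rho> v (word_act \<rho> w f)"
      using linear_word_act[of v] by (simp add: linear_op_def)
    then show ?case
      by (simp add: mult_single act_single word_act_add mult.assoc flip: fls_const_mult_const)
  next
    case (add p q)
    then show ?case
      using act_linear[of "Poly_Mapping.single v c"]
      by (simp add: linear_op_def act_add distrib_left)
  qed
next
  case (add p q)
  then show ?case by (simp add: act_add distrib_right)
qed

end

section \<open>The ring of differential operators\<close>

lemma linear_op_deriv: "linear_op fls_deriv"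
  by (simp add: linear_op_def)

lemma linear_op_funpow: "linear_op D \<Longrightarrow> linear_op (D ^^ n)"
  by (induction n) (simp_all add: linear_op_def)

lemma linear_op_Diff: "D \<in> Diff V \<Longrightarrow> linear_op D"
  using linear_op_funpow[OF linear_op_deriv] unfolding linear_op_def
  by (auto simp: Diff_def diff_op_def algebra_simps sum.distrib sum_distrib_left)

lemma Diff_subset_UNIV: "Diff V \<subseteq> Diff UNIV"
  by (auto simp: Diff_def)

lemma diff_op_in_Diff: "diff_op \<xi> k \<in> Diff UNIV"
  by (auto simp: Diff_def)

lemma diff_op_extend:
  assumes "k \<le> m"
  shows "diff_op \<xi> k = diff_op (\<lambda>j. if j \<le> k then \<xi> j else 0) m"
  unfolding diff_op_def using assms
  by (intro ext sum.mono_neutral_cong_left) auto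

lemma Diff_add:
  assumes "D \<in> Diff UNIV" "E \<in> Diff UNIV"
  shows "(\<lambda>f. D f + E f) \<in> Diff UNIV"
proof -
  obtain \<xi> k \<eta> l where D: "D = diff_op \<xi> k" and E: "E = diff_op \<eta> l"
    using assms by (auto simp: Diff_def)
  obtain \<xi>' where D': "D = diff_op \<xi>' (max k l)"
    using diff_op_extend[of k "max k l"] D by (metis max.cobounded1)
  obtain \<eta>' where E': "E = diff_op \<eta>' (max k l)"
    using diff_op_extend[of l "max k l"] E by (metis max.cobounded2)
  have "(\<lambda>f. D f + E f) = diff_op (\<lambda>j. \<xi>' j + \<eta>' j) (max k l)"
    unfolding D' E' by (simp add: diff_op_def fun_eq_iff algebra_simps sum.distrib)
  then show ?thesis by (simp add: diff_op_in_Diff)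
qed

lemma Diff_mult_left:
  assumes "D \<in> Diff UNIV" shows "(\<lambda>f. g * D f) \<in> Diff UNIV"
proof -
  obtain \<xi> k where "D = diff_op \<xi> k" using assms by (auto simp: Diff_def)
  then have "(\<lambda>f. g * D f) = diff_op (\<lambda>j. g * \<xi> j) k"
    by (simp add: diff_op_def fun_eq_iff sum_distrib_left mult.assoc)
  then show ?thesis by (simp add: diff_op_in_Diff)
qed

lemma Diff_id: "id \<in> Diff UNIV"
proof -
  have "id = diff_op (\<lambda>_. 1) 0" by (simp add: diff_op_def fun_eq_iff)
  then show ?thesis by (metis diff_op_in_Diff)
qed

lemma Diff_zero: "(\<lambda>f. 0) \<in> Diff UNIV"
  using Diff_mult_left[OF Diff_id, of 0] by simp

lemma Diff_minus: "D \<in> Diff UNIV \<Longrightarrow> (\<lambda>f. - D f) \<in> Diff UNIV"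
  using Diff_mult_left[of D "- 1"] by simp

lemma Diff_sum:
  "(\<And>x. x \<in> A \<Longrightarrow> D x \<in> Diff UNIV) \<Longrightarrow> (\<lambda>f. \<Sum>x\<in>A. D x f) \<in> Diff UNIV"
  by (induction A rule: infinite_finite_induct) (simp_all add: Diff_zero Diff_add)

text \<open>By the Leibniz rule \<open>\<partial> \<circ> \<Sum> \<xi>\<^sub>j \<partial>\<^sup>j = \<Sum> \<xi>\<^sub>j' \<partial>\<^sup>j + \<Sum> \<xi>\<^sub>j \<partial>\<^sup>j\<^sup>+\<^sup>1\<close>, and the second sum is the operator with the
  coefficient sequence moved up by one.\<close>

lemma Diff_deriv:
  assumes "D \<in> Diff UNIV" shows "(\<lambda>f. fls_deriv (D f)) \<in> Diff UNIV"
proof -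
  obtain \<xi> k where "D = diff_op \<xi> k" using assms by (auto simp: Diff_def)
  then have "fls_deriv (D f) = diff_op (\<lambda>j. fls_deriv (\<xi> j)) k f
      + diff_op (case_nat 0 \<xi>) (Suc k) f" for f
    unfolding diff_op_def sum.atMost_Suc_shift
    by (simp add: fls_deriv_sum sum.distrib add.commute)
  then show ?thesis
    by (simp add: Diff_add diff_op_in_Diff)
qed

lemma Diff_comp:
  assumes "D \<in> Diff UNIV" "E \<in> Diff UNIV"
  shows "D \<circ> E \<in> Diff UNIV"
proof -
  obtain \<xi> k where D: "D = diff_op \<xi> k" using assms by (auto simp: Diff_def)
  have "(\<lambda>f. (fls_deriv ^^ j) (E f)) \<in> Diff UNIV" for j
    by (induction j) (simp_all add: assms(2) Diff_deriv)
  then have "(\<lambda>f. \<Sum>j\<le>k. \<xi> j * (fls_deriv ^^ j) (E f)) \<in> Diff UNIV"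
    by (intro Diff_sum Diff_mult_left)
  then show ?thesis by (simp add: D diff_op_def comp_def)
qed

lemma Diff_ring_is_ring: "ring (Diff_ring UNIV)"
proof (intro ringI abelian_groupI monoidI; (elim bexE)?)
  fix D assume "D \<in> carrier (Diff_ring UNIV)"
  then show "\<exists>E\<in>carrier (Diff_ring UNIV).
      E \<oplus>\<^bsub>Diff_ring UNIV\<^esub> D = \<zero>\<^bsub>Diff_ring UNIV\<^esub>"
    by (intro bexI[of _ "\<lambda>f. - D f"]) (simp_all add: Diff_ring_def Diff_minus)
qed (use linear_op_Diff in
  \<open>auto simp: Diff_ring_def Diff_add Diff_comp Diff_id Diff_zero fun_eq_iff algebra_simps linear_op_def\<close>)

section \<open>Homomorphisms out of a quotient ring\<close>

text \<open>The universal property of a quotient by a two-sided ideal given by generators. It is used twice: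
  for the enveloping algebra as a quotient of the free algebra, and for the central quotient.\<close>

lemma ring_hom_factors_genideal:
  fixes R (structure) and S (structure)
  assumes "ring_hom_ring R S f" and G: "G \<subseteq> carrier R" and "\<And>g. g \<in> G \<Longrightarrow> f g = \<zero>\<^bsub>S\<^esub>"
  obtains g where "ring_hom_ring (R Quot Idl G) S g" and "\<And>r. r \<in> carrier R \<Longrightarrow> g (Idl G +> r) = f r"
proof -
  interpret f: ring_hom_ring R S f by fact
  interpret I: ideal "Idl G" R using G by (rule f.R.genideal_ideal)
  define g where "g C = the_elem (f ` C)" for C
  have ker: "a_kernel R S f = {r \<in> carrier R. f r = \<zero>\<^bsub>S\<^esub>}"
    by (rule a_kernel_def')
  have "G \<subseteq> a_kernel R S f"
    unfolding ker using G assms(3) by blast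
  then have "Idl G \<subseteq> a_kernel R S f"
    by (rule f.R.genideal_minimal[OF f.kernel_is_ideal])
  then have f0: "f i = \<zero>\<^bsub>S\<^esub>" if "i \<in> Idl G" for i
    using that unfolding ker by blast
  have g: "g (Idl G +> r) = f r" if r: "r \<in> carrier R" for r
    unfolding g_def
  proof (rule the_elem_image_unique)
    show "Idl G +> r \<noteq> {}" using I.a_rcos_self[OF r] by blast
    fix y assume "y \<in> Idl G +> r"
    then obtain i where i: "i \<in> Idl G" and y: "y = i \<oplus> r" by (auto simp: a_r_coset_def')
    show "f y = f r"
      using i r by (simp add: y f0)
  qed
  have car: "carrier (R Quot Idl G) = (\<lambda>r. Idl G +> r) ` carrier R"
    by (auto simp: FactRing_def A_RCOSETS_def')
  have "ring_hom_ring (R Quot Idl G) S g"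
  proof (rule ring_hom_ringI)
    show "ring (R Quot Idl G)" by (rule I.quotient_is_ring)
    show "ring S" by (rule f.S.ring_axioms)
    show "g \<one>\<^bsub>R Quot Idl G\<^esub> = \<one>\<^bsub>S\<^esub>"
      by (simp add: FactRing_def g)
  qed (auto simp: car g, auto simp: FactRing_def I.rcoset_mult_add I.a_rcos_sum g)
  with g that show ?thesis by blast
qed

section \<open>The enveloping algebra of sl(2) and its central quotients\<close>

lemma ring_ring_of_type_algebra: "ring (ring_of_type_algebra :: 'a::ring_1 ring)"
proof -
  have "\<exists>y. x + y = 0" "\<exists>y. y + x = 0" for x :: 'a
    using add.right_inverse add.left_inverse by blast+
  then show ?thesis
    by unfold_locales (auto simp: ring_of_type_algebra_def algebra_simps Units_def)
qed

lemma ring_of_type_algebra_simps: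
  "carrier ring_of_type_algebra = (UNIV :: 'a::ring_1 set)"
  "x \<otimes>\<^bsub>ring_of_type_algebra\<^esub> y = (x * y :: 'a)"
  "x \<oplus>\<^bsub>ring_of_type_algebra\<^esub> y = (x + y :: 'a)"
  "\<one>\<^bsub>ring_of_type_algebra\<^esub> = (1 :: 'a)"
  "\<zero>\<^bsub>ring_of_type_algebra\<^esub> = (0 :: 'a)"
  by (simp_all add: ring_of_type_algebra_def)

lemma minus_ring_of_type_algebra: "x \<ominus>\<^bsub>ring_of_type_algebra\<^esub> y = (x - y :: 'a::ring_1)"
proof -
  interpret ring "ring_of_type_algebra :: 'a ring" by (rule ring_ring_of_type_algebra)
  have "\<ominus>\<^bsub>ring_of_type_algebra\<^esub> y = - y"
    by (rule minus_equality) (simp_all add: ring_of_type_algebra_simps)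
  then show ?thesis by (simp add: a_minus_def ring_of_type_algebra_simps)
qed

abbreviation sl2_relations :: "sl2 free_alg set" where
  "sl2_relations \<equiv> uea_relations sl2_scale sl2_bracket"

lemma U_ideal: "ideal (Idl\<^bsub>ring_of_type_algebra\<^esub> sl2_relations) (ring_of_type_algebra :: sl2 free_alg ring)"
  by (rule ring.genideal_ideal[OF ring_ring_of_type_algebra]) (simp add: ring_of_type_algebra_simps)

lemma U_class_hom: "ring_hom_ring ring_of_type_algebra U_sl2 U_class"
  unfolding U_sl2_def U_class_def by (rule ideal.rcos_ring_hom_ring[OF U_ideal])

lemma U_ring: "ring U_sl2"
  unfolding U_sl2_def by (rule ideal.quotient_is_ring[OF U_ideal])

lemma U_class_in_carrier: "U_class p \<in> carrier U_sl2"
  by (simp add: U_sl2_def U_class_def FactRing_def A_RCOSETS_def' ring_of_type_algebra_simps)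
    blast

lemma U_class_simps:
  "U_class p \<oplus>\<^bsub>U_sl2\<^esub> U_class p' = U_class (p + p')"
  "U_class p \<otimes>\<^bsub>U_sl2\<^esub> U_class p' = U_class (p * p')"
  "U_class p \<ominus>\<^bsub>U_sl2\<^esub> U_class p' = U_class (p - p')"
  "\<zero>\<^bsub>U_sl2\<^esub> = U_class 0" "\<one>\<^bsub>U_sl2\<^esub> = U_class 1"
proof -
  interpret U_class: ring_hom_ring ring_of_type_algebra U_sl2 U_class by (rule U_class_hom)
  show
    "U_class p \<oplus>\<^bsub>U_sl2\<^esub> U_class p' = U_class (p + p')"
    "U_class p \<otimes>\<^bsub>U_sl2\<^esub> U_class p' = U_class (p * p')"
    "U_class p \<ominus>\<^bsub>U_sl2\<^esub> U_class p' = U_class (p - p')"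
    "\<zero>\<^bsub>U_sl2\<^esub> = U_class 0" "\<one>\<^bsub>U_sl2\<^esub> = U_class 1"
    using U_class.hom_add[of p p'] U_class.hom_mult[of p p'] U_class.hom_zero U_class.hom_one
      U_class.hom_add[of p "\<ominus>\<^bsub>ring_of_type_algebra\<^esub> p'"]
      U_class.hom_a_inv[of p'] minus_ring_of_type_algebra[of p p']
    by (simp_all add: ring_of_type_algebra_simps a_minus_def)
qed

lemma carrier_U: "carrier U_sl2 = range U_class"
  by (auto simp: U_sl2_def U_class_def FactRing_def A_RCOSETS_def' ring_of_type_algebra_simps)

lemma U_class_relation:
  assumes "r \<in> sl2_relations" shows "U_class r = U_class 0"
proof -
  interpret ideal "Idl\<^bsub>ring_of_type_algebra\<^esub> sl2_relations" "ring_of_type_algebra :: sl2 free_alg ring"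
    by (rule U_ideal)
  have "r \<in> Idl\<^bsub>ring_of_type_algebra\<^esub> sl2_relations"
    using assms ring.genideal_self[OF ring_ring_of_type_algebra, of sl2_relations]
    by (auto simp: ring_of_type_algebra_simps)
  then have "U_class r = \<zero>\<^bsub>U_sl2\<^esub>"
    by (simp add: U_class_def U_sl2_def FactRing_def a_rcos_const)
  then show ?thesis by (simp add: U_class_simps)
qed

lemma U_monoid: "Group.monoid U_sl2"
  using U_ring by (rule ring.is_monoid)

text \<open>A representative in the free algebra of the generator of the ideal by which the enveloping algebra is
  divided.\<close>

definition casimir_relation :: "complex \<Rightarrow> sl2 free_alg" where
  "casimir_relation c = fscalar 4 * ((fgen (sl2_L 0) - fscalar (1/2)) ^ 2
      - fgen (sl2_L (-1)) * fgen (sl2_L 1)) - fscalar ((2 * c + 1)\<^sup>2)"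

lemma U_class_casimir_relation:
  "Casimir \<ominus>\<^bsub>U_sl2\<^esub> U_scalar ((2 * c + 1)\<^sup>2) = U_class (casimir_relation c)"
proof -
  have "U_class p [^]\<^bsub>U_sl2\<^esub> (2::nat) = U_class (p ^ 2)" for p
    by (simp add: numeral_2_eq_2 U_class_simps monoid.nat_pow_Suc monoid.nat_pow_0 U_monoid)
  then show ?thesis
    by (simp add: Casimir_def casimir_relation_def U_gen_def U_scalar_def U_class_simps)
qed

definition central_quotient_class :: "complex \<Rightarrow> sl2 free_alg \<Rightarrow> sl2 free_alg set set" where
  "central_quotient_class c p = Casimir_ideal c +>\<^bsub>U_sl2\<^esub> U_class p"

lemma Casimir_ideal_ideal: "ideal (Casimir_ideal c) U_sl2"
  unfolding Casimir_ideal_def U_class_casimir_relation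
  by (rule ring.genideal_ideal[OF U_ring]) (simp add: U_class_in_carrier)

lemma central_quotient_hom:
  "ring_hom_ring ring_of_type_algebra (U_sl2 Quot Casimir_ideal c) (central_quotient_class c)"
proof -
  have "(+>\<^bsub>U_sl2\<^esub>) (Casimir_ideal c) \<circ> U_class
      \<in> ring_hom ring_of_type_algebra (U_sl2 Quot Casimir_ideal c)"
    by (rule ring_hom_trans[OF ring_hom_ring.homh[OF U_class_hom] ideal.rcos_ring_hom[OF Casimir_ideal_ideal]])
  then show ?thesis
    by (intro ring_hom_ringI2 ring_ring_of_type_algebra ideal.quotient_is_ring[OF Casimir_ideal_ideal])
      (simp add: central_quotient_class_def[abs_def] comp_def)
qed

lemma carrier_central_quotient:
  "carrier (U_sl2 Quot Casimir_ideal c) = range (central_quotient_class c)"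
  by (auto simp: central_quotient_class_def FactRing_def A_RCOSETS_def' carrier_U)

text \<open>The ideal of the free algebra whose quotient is the central quotient of the enveloping algebra.\<close>

definition central_kernel :: "complex \<Rightarrow> sl2 free_alg set" where
  "central_kernel c = {p. central_quotient_class c p = \<zero>\<^bsub>U_sl2 Quot Casimir_ideal c\<^esub>}"

lemma ideal_congruence_ring_hom_kernel:
  assumes "ring_hom_ring (ring_of_type_algebra :: 'g free_alg ring) S f"
  shows "ideal_congruence fscalar {p. f p = \<zero>\<^bsub>S\<^esub>}"
proof -
  interpret f: ring_hom_ring "ring_of_type_algebra :: 'g free_alg ring" S f by fact
  have cl: "f p \<in> carrier S" for p
    by (rule f.hom_closed) (simp add: ring_of_type_algebra_simps)
  show ?thesis
    using f.hom_zero f.hom_add f.hom_mult cl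
    by unfold_locales (auto simp: ring_of_type_algebra_simps)
qed

interpretation central_kernel: ideal_congruence fscalar "central_kernel c"
  unfolding central_kernel_def by (rule ideal_congruence_ring_hom_kernel[OF central_quotient_hom])

lemma central_kernel_relations: "sl2_relations \<subseteq> central_kernel c"
proof
  fix r assume "r \<in> sl2_relations"
  then have "central_quotient_class c r = central_quotient_class c 0"
    by (simp add: central_quotient_class_def U_class_relation)
  also have "\<dots> = \<zero>\<^bsub>U_sl2 Quot Casimir_ideal c\<^esub>"
    using central_kernel.J_zero[of c] by (simp add: central_kernel_def)
  finally show "r \<in> central_kernel c" by (simp add: central_kernel_def)
qed

lemma central_kernel_casimir: "casimir_relation c \<in> central_kernel c"
proof -
  interpret ideal "Casimir_ideal c" U_sl2 by (rule Casimir_ideal_ideal)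
  have "U_class (casimir_relation c) \<in> Casimir_ideal c"
    unfolding Casimir_ideal_def U_class_casimir_relation
    by (rule ring.genideal_self'[OF U_ring]) (rule U_class_in_carrier)
  then show ?thesis
    by (simp add: central_kernel_def central_quotient_class_def FactRing_def a_rcos_const)
qed

lemma central_quotient_hom_lift:
  fixes S (structure)
  assumes "ring_hom_ring ring_of_type_algebra S f"
    and rel: "\<And>r. r \<in> sl2_relations \<Longrightarrow> f r = \<zero>" and cas: "f (casimir_relation c) = \<zero>"
  obtains \<Phi> where "ring_hom_ring (U_sl2 Quot Casimir_ideal c) S \<Phi>"
    and "\<And>p. \<Phi> (central_quotient_class c p) = f p"
proof -
  have "sl2_relations \<subseteq> carrier ring_of_type_algebra"
    by (simp add: ring_of_type_algebra_simps)
  from ring_hom_factors_genideal[OF assms(1) this rel]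
  obtain g where g: "ring_hom_ring U_sl2 S g" and g_class: "\<And>p. g (U_class p) = f p"
    unfolding U_sl2_def U_class_def by (auto simp: ring_of_type_algebra_simps)
  have "{U_class (casimir_relation c)} \<subseteq> carrier U_sl2"
    by (simp add: U_class_in_carrier)
  from ring_hom_factors_genideal[OF g this]
  obtain \<Phi> where "ring_hom_ring (U_sl2 Quot Casimir_ideal c) S \<Phi>"
    and "\<And>u. u \<in> carrier U_sl2 \<Longrightarrow> \<Phi> (Casimir_ideal c +>\<^bsub>U_sl2\<^esub> u) = g u"
    unfolding Casimir_ideal_def U_class_casimir_relation by (auto simp: g_class cas)
  then show ?thesis
    using that by (simp add: central_quotient_class_def U_class_in_carrier g_class)
qed

abbreviation casimir_poly :: "complex \<Rightarrow> complex poly" where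
  "casimir_poly c \<equiv> [:- (c * (c + 1)), -1, 1:]"

lemma add_relation: "fgen (x + y) - (fgen x + fgen y) \<in> central_kernel c"
  using central_kernel_relations[of c] unfolding uea_relations_def by blast

lemma scale_relation: "fgen (sl2_scale t x) - fscalar t * fgen x \<in> central_kernel c"
  using central_kernel_relations[of c] unfolding uea_relations_def by blast

lemma bracket_relation:
  "fgen x * fgen y - fgen y * fgen x - fgen (sl2_bracket x y) \<in> central_kernel c"
  using central_kernel_relations[of c] unfolding uea_relations_def by blast

text \<open>The generators of the free algebra are all the vectors of sl(2); modulo the relations of linearity
  only the three basis vectors are left.\<close>

lemma fgen_cong:
  "fgen (x, y, z) - (fscalar x * fgen (sl2_L (-1)) + fscalar y * fgen (sl2_L 0)
     + fscalar z * fgen (sl2_L 1)) \<in> central_kernel c"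
proof -
  let ?u = "sl2_scale x (sl2_L (-1))" and ?v = "sl2_scale y (sl2_L 0)" and ?w = "sl2_scale z (sl2_L 1)"
  have "fgen (?u + ?v + ?w) - (fgen (?u + ?v) + fgen ?w) + (fgen (?u + ?v) - (fgen ?u + fgen ?v))
      + (fgen ?u - fscalar x * fgen (sl2_L (-1))) + (fgen ?v - fscalar y * fgen (sl2_L 0))
      + (fgen ?w - fscalar z * fgen (sl2_L 1)) \<in> central_kernel c"
    by (intro central_kernel.J_add add_relation scale_relation)
  moreover have "(p - (uv + w)) + (uv - (u + v)) + (u - u') + (v - v') + (w - w') = p - (u' + v' + w')"
    for p uv u v w u' v' w' :: "sl2 free_alg"
    by simp
  ultimately show ?thesis
    by (simp only: sl2_basis[of x y z])
qed

lemma weight_relation: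
  "fgen (sl2_L 0) * fgen (sl2_L (-1)) - fgen (sl2_L (-1)) * fgen (sl2_L 0) - fgen (sl2_L (-1)) \<in> central_kernel c"
  "fgen (sl2_L 1) * fgen (sl2_L 0) - fgen (sl2_L 0) * fgen (sl2_L 1) - fgen (sl2_L 1) \<in> central_kernel c"
proof -
  have "sl2_bracket (sl2_L 0) (sl2_L (-1)) = sl2_L (-1)" "sl2_bracket (sl2_L 1) (sl2_L 0) = sl2_L 1"
    by (simp_all add: sl2_L_def)
  then show
    "fgen (sl2_L 0) * fgen (sl2_L (-1)) - fgen (sl2_L (-1)) * fgen (sl2_L 0) - fgen (sl2_L (-1)) \<in> central_kernel c"
    "fgen (sl2_L 1) * fgen (sl2_L 0) - fgen (sl2_L 0) * fgen (sl2_L 1) - fgen (sl2_L 1) \<in> central_kernel c"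
    using bracket_relation[of "sl2_L 0" "sl2_L (-1)"] bracket_relation[of "sl2_L 1" "sl2_L 0"] by metis+
qed

lemma FE_relation:
  "fgen (sl2_L 1) * fgen (sl2_L (-1)) - fgen (sl2_L (-1)) * fgen (sl2_L 1)
     - fscalar 2 * fgen (sl2_L 0) \<in> central_kernel c"
proof -
  have "sl2_bracket (sl2_L 1) (sl2_L (-1)) = sl2_scale 2 (sl2_L 0)"
    by (simp add: sl2_L_def)
  then show ?thesis
    using central_kernel.J_add[OF bracket_relation[of "sl2_L 1" "sl2_L (-1)"] scale_relation[of 2 "sl2_L 0"]]
    by (simp only: diff_add_cancel add_diff_eq)
qed

lemma ev_casimir_poly:
  "free_alg.ev a (casimir_poly c) = a * a - a - fscalar (c * (c + 1))"
  by (simp only: free_alg.ev_pCons free_alg.ev_0 free_alg.s_one free_alg.s_minus)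
    (simp add: algebra_simps)

text \<open>Complete the square in reverse: \<open>(x - 1/2)\<^sup>2 - (2c + 1)\<^sup>2/4 = x\<^sup>2 - x - c(c + 1)\<close>.\<close>

lemma casimir_relation_eq:
  "casimir_relation c = fscalar (- 4) * (fgen (sl2_L (-1)) * fgen (sl2_L 1)
     - free_alg.ev (fgen (sl2_L 0)) (casimir_poly c))"
proof -
  let ?a = "fgen (sl2_L 0)"
  have "?a * fscalar (1/2) + fscalar (1/2) * ?a = (fscalar (1/2) + fscalar (1/2)) * ?a"
    by (simp only: fscalar_central[of ?a] distrib_right)
  also have "\<dots> = ?a"
    by (simp only: free_alg.s_one flip: free_alg.s_add) (simp add: free_alg.s_one)
  finally have 1: "?a * fscalar (1/2) + fscalar (1/2) * ?a = ?a" .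
  have 2: "fscalar (1/2) * fscalar (1/2) = (fscalar (1/4) :: sl2 free_alg)"
    by (simp flip: free_alg.s_mult)
  have "(?a - fscalar (1/2)) ^ 2 = ?a * ?a - (?a * fscalar (1/2) + fscalar (1/2) * ?a) + fscalar (1/2) * fscalar (1/2)"
    by (simp only: power2_eq_square algebra_simps)
  then have half: "(?a - fscalar (1/2)) ^ 2 = ?a * ?a - ?a + fscalar (1/4)"
    by (simp only: 1 2)
  have "(2 * c + 1)\<^sup>2 = 4 * (c * (c + 1) + 1/4)"
    by (simp add: power2_eq_square algebra_simps)
  then have "fscalar ((2 * c + 1)\<^sup>2) = fscalar 4 * (fscalar (c * (c + 1)) + fscalar (1/4) :: sl2 free_alg)"
    by (simp only: free_alg.s_mult free_alg.s_add)
  moreover have "k * (u + r - v) - k * (t + r) = - k * (v - (u - t))" for k u v r t :: "sl2 free_alg"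
    by (simp add: algebra_simps)
  ultimately show ?thesis
    unfolding casimir_relation_def half ev_casimir_poly free_alg.s_minus by simp
qed

lemma EF_relation:
  "fgen (sl2_L (-1)) * fgen (sl2_L 1) - free_alg.ev (fgen (sl2_L 0)) (casimir_poly c) \<in> central_kernel c"
  using central_kernel_casimir[of c] unfolding casimir_relation_eq
  by (rule central_kernel.scalar_cancel[rotated]) simp

text \<open>This matches \<open>FE = EF + 2A\<close>, the relation \<open>[L\<^sub>1, L\<^sub>-\<^sub>1] = 2 L\<^sub>0\<close>.\<close>

lemma ev_casimir_poly_shift:
  "free_alg.ev a (casimir_poly c \<circ>\<^sub>p [:1, 1:]) = free_alg.ev a (casimir_poly c) + fscalar 2 * a"
proof -
  have "casimir_poly c \<circ>\<^sub>p [:1, 1:] = casimir_poly c + [:0, 2:]"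
    by (simp add: pcompose_pCons)
  moreover have "free_alg.ev a [:0, 2:] = fscalar 2 * a"
    by (simp add: free_alg.ev_pCons free_alg.ev_0 free_alg.s_zero) (rule fscalar_central)
  ultimately show ?thesis by (simp only: free_alg.ev_add)
qed

interpretation central_kernel: weyl_relations fscalar "central_kernel c"
  "fgen (sl2_L 0)" "fgen (sl2_L (-1))" "fgen (sl2_L 1)" "casimir_poly c"
proof (unfold_locales, goal_cases)
  case 1
  show ?case
    using central_kernel.J_minus[OF weight_relation(1)[of c]]
    by (simp only: free_alg.s_one free_alg.s_minus) (simp add: algebra_simps)
next
  case 2
  show ?case
    using weight_relation(2)[of c]
    by (simp only: free_alg.s_one) (simp add: algebra_simps)
next
  case 3
  show ?case by (rule EF_relation)
next
  case 4
  show ?case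
    using central_kernel.J_add[OF FE_relation EF_relation]
    by (simp only: ev_casimir_poly_shift) (simp add: algebra_simps)
qed

text \<open>By induction on words, read from the right: prefixing a letter is left multiplication by a
  combination of the three basis vectors.\<close>

lemma free_alg_has_normal_form: "central_kernel.has_normal_form c p"
proof (induction p rule: free_alg_induct)
  case (add p q)
  then show ?case by (rule central_kernel.has_normal_form_add)
next
  case (single w t)
  obtain xs where "w = Word xs" by (cases w)
  moreover have "central_kernel.has_normal_form c (Poly_Mapping.single (Word xs) t)"
  proof (induction xs)
    case Nil
    show ?case
      using central_kernel.has_normal_form_term[of c "[:t:]" 0]
      by (simp add: single_Nil free_alg.ev_const central_kernel.basis_def)
  next
    case (Cons g xs)
    let ?u = "Poly_Mapping.single (Word xs) t :: sl2 free_alg"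
    obtain x y z where g: "g = (x, y, z)" by (cases g)
    have "central_kernel.cong c (fgen g * ?u) ((fscalar x * fgen (sl2_L (-1)) + fscalar y * fgen (sl2_L 0)
        + fscalar z * fgen (sl2_L 1)) * ?u)"
      using fgen_cong by (intro central_kernel.cong_right) (simp add: central_kernel.cong_def g)
    moreover have "central_kernel.has_normal_form c ((fscalar x * fgen (sl2_L (-1)) + fscalar y * fgen (sl2_L 0)
        + fscalar z * fgen (sl2_L 1)) * ?u)"
      unfolding distrib_right mult.assoc
      by (intro central_kernel.has_normal_form_add central_kernel.has_normal_form_scalar_left
          central_kernel.has_normal_form_a_left central_kernel.has_normal_form_E_left
          central_kernel.has_normal_form_F_left Cons.IH)
    ultimately show ?case
      unfolding single_Cons by (rule central_kernel.has_normal_form_cong)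
  qed
  ultimately show ?case by simp
qed

section \<open>Representations attached to a triple\<close>

lemma (in linear_action) act_in_Diff:
  assumes "\<And>x. \<rho> x \<in> Diff UNIV" shows "act \<rho> p \<in> Diff UNIV"
proof (induction p rule: free_alg_induct)
  case (single w c)
  obtain xs where w: "w = Word xs" by (cases w)
  have "act \<rho> (Poly_Mapping.single (Word xs) c) \<in> Diff UNIV"
  proof (induction xs)
    case Nil
    have "act \<rho> (Poly_Mapping.single (Word []) c) = (\<lambda>f. fls_const c * id f)"
      by (simp add: fun_eq_iff act_single)
    then show ?case by (simp only: Diff_mult_left Diff_id)
  next
    case (Cons x xs)
    have "act \<rho> (Poly_Mapping.single (Word (x # xs)) c) = \<rho> x \<circ> act \<rho> (Poly_Mapping.single (Word xs) c)"
      by (simp add: fun_eq_iff single_Cons act_mult act_fgen)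
    then show ?case by (simp only: Diff_comp assms Cons.IH)
  qed
  then show ?case by (simp only: w)
next
  case (add p q)
  have "act \<rho> (p + q) = (\<lambda>f. act \<rho> p f + act \<rho> q f)"
    by (simp add: fun_eq_iff act_add)
  then show ?case by (simp only: Diff_add add)
qed

lemma (in linear_action) act_hom:
  assumes "\<And>x. \<rho> x \<in> Diff UNIV"
  shows "ring_hom_ring ring_of_type_algebra (Diff_ring UNIV) (act \<rho>)"
  by (intro ring_hom_ringI ring_ring_of_type_algebra Diff_ring_is_ring)
    (simp_all add: ring_of_type_algebra_simps Diff_ring_def act_in_Diff[OF assms] fun_eq_iff
      act_add act_mult act_one)

text \<open>The operator identity \<open>p(\<rho>(x)) h = h p(\<rho>(x) - 1)\<close>, which extends the case where \<open>p\<close> is the variable.\<close>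

lemma (in linear_action) act_ev_shift:
  assumes h: "\<And>f. \<rho> x (h * f) = h * (\<rho> x f - f)"
  shows "act \<rho> (free_alg.ev (fgen x) p) (h * f)
    = h * act \<rho> (free_alg.ev (fgen x) (p \<circ>\<^sub>p [:-1, 1:])) f"
proof (induction p)
  case (pCons r p)
  have "pCons r p \<circ>\<^sub>p [:-1, 1:] = [:r:] + [:-1, 1:] * (p \<circ>\<^sub>p [:-1, 1:])"
    by (simp add: pcompose_pCons)
  then show ?case
    using pCons.IH
    by (simp only: free_alg.ev_pCons[of _ r p] free_alg.ev_add free_alg.ev_mult free_alg.ev_const
        free_alg.ev_linear act_add act_mult act_fgen act_fscalar h)
      (simp add: scalar_op_def algebra_simps)
qed (simp add: free_alg.ev_0 act_0)

lemma associated_triple_L0: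
  assumes "associated_triple V \<rho> h b c"
  shows "\<rho> (sl2_L 0) f = - (h / fls_deriv h) * fls_deriv f + b * f"
  using assms by (auto simp: associated_triple_def S0_formulas_def S1_formulas_def S2_formulas_def)

text \<open>The logarithmic form of the leading coefficient of \<open>\<rho>(L\<^sub>0) = - (h/h') \<partial> + b\<close> makes
  multiplication by \<open>h\<close> a weight vector: \<open>[\<rho>(L\<^sub>0), h] = - h\<close>.\<close>

lemma associated_triple_shift:
  assumes "associated_triple V \<rho> h b c"
  shows "\<rho> (sl2_L 0) (h * f) = h * (\<rho> (sl2_L 0) f - f)"
proof -
  have "fls_deriv h \<noteq> 0" using assms by (simp add: associated_triple_def)
  then show ?thesis
    by (simp add: associated_triple_L0[OF assms] field_simps)
qed

text \<open>With \<open>A = \<rho>(L\<^sub>0)\<close>, the three families are \<open>\<rho>(L\<^sub>-\<^sub>1) = h\<^sup>-\<^sup>1 P(A)\<close> and \<open>\<rho>(L\<^sub>1) = h Q(A)\<close> for factorisations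
  \<open>P(x - 1) Q(x) = x\<^sup>2 - x - c(c + 1)\<close> with \<open>P\<close> of degree \<open>0\<close>, \<open>1\<close>, \<open>2\<close> respectively, and conjugation by
  \<open>h\<close> turns \<open>P(A)\<close> into \<open>P(A - 1)\<close>.\<close>

lemma associated_triple_EF:
  assumes triple: "associated_triple V \<rho> h b c" and lin: "\<And>x. linear_op (\<rho> x)"
  shows "\<rho> (sl2_L (-1)) (\<rho> (sl2_L 1) f)
    = \<rho> (sl2_L 0) (\<rho> (sl2_L 0) f) - \<rho> (sl2_L 0) f - fls_const (c * (c + 1)) * f"
proof -
  let ?A = "\<rho> (sl2_L 0)"
  have h': "fls_deriv h \<noteq> 0" using triple by (simp add: associated_triple_def)
  then have h: "h \<noteq> 0" by auto
  note shift = associated_triple_shift[OF triple]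
  have add: "?A (u + v) = ?A u + ?A v" for u v
    using lin by (simp add: linear_op_def)
  have scale: "?A (fls_const t * u) = fls_const t * ?A u" for t u
    using lin by (simp add: linear_op_def)
  have diff: "?A (u - v) = ?A u - ?A v" for u v
    using add[of "u - v" v] by simp
  have cancel: "inverse h * (h * u) = u" for u
    using h by (simp add: mult.assoc[symmetric])
  consider "S0_formulas \<rho> h b c" | "S1_formulas \<rho> h b c" | "S2_formulas \<rho> h b c"
    using triple by (auto simp: associated_triple_def)
  then show ?thesis
  proof cases
    case 1
    then show ?thesis by (simp add: S0_formulas_def cancel)
  next
    case 2
    \<comment> \<open>Expressed through \<open>A\<close>, the operators are \<open>h\<^sup>-\<^sup>1 (A - c)\<close> and \<open>h (A + c)\<close>.\<close>
    have E: "\<rho> (sl2_L (-1)) u = inverse h * (?A u - fls_const c * u)" for u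
      using 2 h by (simp add: S1_formulas_def associated_triple_L0[OF triple] field_simps power_int_minus)
    have F: "\<rho> (sl2_L 1) u = h * (?A u + fls_const c * u)" for u
      using 2 h by (simp add: S1_formulas_def associated_triple_L0[OF triple] field_simps power2_eq_square)
    define g where "g = ?A f + fls_const c * f"
    have "?A (h * g) - fls_const c * (h * g) = h * (?A g - g - fls_const c * g)"
      by (simp only: shift) (simp add: algebra_simps)
    then have "\<rho> (sl2_L (-1)) (\<rho> (sl2_L 1) f) = ?A g - g - fls_const c * g"
      by (simp only: E F g_def[symmetric] cancel)
    also have "?A g = ?A (?A f) + fls_const c * ?A f"
      by (simp only: g_def add scale)
    also have "\<dots> - g - fls_const c * g = ?A (?A f) - ?A f - fls_const c * (fls_const c + 1) * f"
      by (simp only: g_def) (simp add: algebra_simps)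
    also have "fls_const c * (fls_const c + 1) = fls_const (c * (c + 1))"
      by (simp add: distrib_left flip: fls_plus_const)
    finally show ?thesis .
  next
    case 3
    let ?k = "fls_const (c * (c + 1))"
    have "\<rho> (sl2_L (-1)) (\<rho> (sl2_L 1) f) = inverse h * (?A (?A (h * f)) + ?A (h * f) - ?k * (h * f))"
      using 3 by (simp add: S2_formulas_def)
    also have "?A (?A (h * f)) + ?A (h * f) - ?k * (h * f) = h * (?A (?A f) - ?A f - ?k * f)"
      by (simp only: shift diff) (simp add: algebra_simps)
    finally show ?thesis by (simp only: cancel)
  qed
qed

theorem theorem3p7:
  fixes V :: "complex fls set" and \<rho> :: "sl2 \<Rightarrow> operator"
    and h b :: "complex fls" and c :: complex
  assumes "V = rational_fls \<or> V = UNIV"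
    and "\<rho> \<in> S_rep V"
    and "associated_triple V \<rho> h b c"
  shows "\<exists>\<Phi>. \<Phi> \<in> ring_hom (U_sl2 Quot Casimir_ideal c) (Diff_ring UNIV) \<and>
           (\<forall>a. \<Phi> (Casimir_ideal c +>\<^bsub>U_sl2\<^esub> U_scalar a) = scalar_op a) \<and>
           (\<forall>x. \<Phi> (Casimir_ideal c +>\<^bsub>U_sl2\<^esub> U_gen x) = \<rho> x) \<and>
           inj_on \<Phi> (carrier (U_sl2 Quot Casimir_ideal c))"
proof -
  note triple = assms(3)
  have hom: "lie_hom_Diff V \<rho>" using assms(2) by (simp add: S_rep_def)
  then have Diff: "\<rho> x \<in> Diff UNIV" for x
    unfolding lie_hom_Diff_def using Diff_subset_UNIV by blast
  interpret linear_action \<rho>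
    by unfold_locales (rule linear_op_Diff[OF Diff])
  let ?a = "fgen (sl2_L 0)"
  have h: "h \<noteq> 0" using triple by (auto simp: associated_triple_def)
  have act_hom: "ring_hom_ring ring_of_type_algebra (Diff_ring UNIV) (act \<rho>)"
    by (rule act_hom) (rule Diff)
  define K where "K = {p. act \<rho> p = \<zero>\<^bsub>Diff_ring UNIV\<^esub>}"
  have K: "p \<in> K \<longleftrightarrow> (\<forall>f. act \<rho> p f = 0)" for p
    by (simp add: K_def Diff_ring_def fun_eq_iff)
  have relations: "act \<rho> r = \<zero>\<^bsub>Diff_ring UNIV\<^esub>" if "r \<in> sl2_relations" for r
  proof -
    have add: "\<rho> (x + y) = (\<lambda>f. \<rho> x f + \<rho> y f)" and scale: "\<rho> (sl2_scale t x) = scalar_op t \<circ> \<rho> x"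
      and bracket: "\<rho> (sl2_bracket x y) = (\<lambda>f. \<rho> x (\<rho> y f) - \<rho> y (\<rho> x f))" for t x y
      using hom unfolding lie_hom_Diff_def by blast+
    have "act \<rho> r f = 0" for f
      using that unfolding uea_relations_def
      by (elim UnE CollectE exE conjE)
        (simp_all only: act_diff act_add act_mult act_fgen act_fscalar add scale bracket comp_apply diff_self)
    then show ?thesis using K[of r] by (simp add: K_def)
  qed
  have casimir: "act \<rho> (casimir_relation c) = \<zero>\<^bsub>Diff_ring UNIV\<^esub>"
  proof -
    have "act \<rho> (casimir_relation c) f = 0" for f
      unfolding casimir_relation_eq ev_casimir_poly act_mult act_diff act_fgen act_fscalar
        associated_triple_EF[OF triple linear]
      by (simp add: scalar_op_def)
    then show ?thesis using K[of "casimir_relation c"] by (simp add: K_def)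
  qed
  obtain \<Phi> where \<Phi>: "ring_hom_ring (U_sl2 Quot Casimir_ideal c) (Diff_ring UNIV) \<Phi>"
    and \<Phi>_class: "\<And>p. \<Phi> (central_quotient_class c p) = act \<rho> p"
    using central_quotient_hom_lift[OF act_hom relations casimir] by blast
  interpret \<Phi>: ring_hom_ring "U_sl2 Quot Casimir_ideal c" "Diff_ring UNIV" \<Phi> by (rule \<Phi>)
  have mem: "p \<in> central_kernel c" if "p \<in> K" for p
  proof (rule central_kernel.larger_kernel_mem)
    show "ideal_congruence fscalar K"
      unfolding K_def by (rule ideal_congruence_ring_hom_kernel[OF act_hom])
    show "central_kernel c \<subseteq> K"
    proof
      fix p assume "p \<in> central_kernel c"
      then show "p \<in> K"
        using \<Phi>_class[of p] \<Phi>.hom_zero by (simp add: central_kernel_def K_def)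
    qed
    have "act \<rho> 1 1 \<noteq> 0" by (simp add: act_one)
    then show "1 \<notin> K" using K by blast
    show "free_alg.ev ?a (p \<circ>\<^sub>p [:-1, 1:]) \<in> K" if "free_alg.ev ?a p \<in> K" for p
    proof -
      have "h * act \<rho> (free_alg.ev ?a (p \<circ>\<^sub>p [:-1, 1:])) f = 0" for f
        using that act_ev_shift[OF associated_triple_shift[OF triple], of p f] K by simp
      then show ?thesis using h K by simp
    qed
  qed (simp_all add: free_alg_has_normal_form that)
  have "inj_on \<Phi> (carrier (U_sl2 Quot Casimir_ideal c))"
  proof (rule \<Phi>.trivial_ker_imp_inj)
    show "a_kernel (U_sl2 Quot Casimir_ideal c) (Diff_ring UNIV) \<Phi> = {\<zero>\<^bsub>U_sl2 Quot Casimir_ideal c\<^esub>}"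
      unfolding a_kernel_def' carrier_central_quotient
      using mem \<Phi>.hom_zero \<Phi>.R.zero_closed[unfolded carrier_central_quotient]
      by (auto simp: \<Phi>_class K_def central_kernel_def)
  qed
  moreover have "\<Phi> (Casimir_ideal c +>\<^bsub>U_sl2\<^esub> U_scalar a) = scalar_op a" for a
    using \<Phi>_class[of "fscalar a"] by (simp add: central_quotient_class_def U_scalar_def act_fscalar)
  moreover have "\<Phi> (Casimir_ideal c +>\<^bsub>U_sl2\<^esub> U_gen x) = \<rho> x" for x
    using \<Phi>_class[of "fgen x"] by (simp add: central_quotient_class_def U_gen_def act_fgen)
  ultimately show ?thesis using \<Phi>.homh by blast
qed

end
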